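(* Let $X$ be the vertex set of a graph and let $\Delta^{\mathrm{NUM}}$ be a graph Laplacian on $X$ which obeys a sharp $L^\infty$ estimate (as defined in the context). Let $\nu>0$, $\tau>0$, $f(u)=u^3-u$, and let $$A\ge A_{cr}:= 1+ 2\sqrt{1+\frac 43\cdot \frac{\nu}{\tau}}.$$ Let $u^0:X\to\mathbb R$ be bounded and let $(u^n)_{n\ge0}$, $u^n:X\to\mathbb R$, be generated from $u^0$ by the fully discrete scheme $$\frac{u^{n+1}-u^n}{\tau} = - \nu (\Delta^{\mathrm{NUM}})^2 u^{n+1} + A \Delta^{\mathrm{NUM}} (u^{n+1}-u^n) +\Delta^{\mathrm{NUM}}( f(u^n) ), \qquad n\ge 0.$$ If $\|u^0\|_{\infty} \le M:=\sqrt{\frac{A+1}3}$, then $$\|u^n\|_{\infty} \le M \qquad\text{for all } n \ge 1.$$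
   Context: A graph Laplacian $\Delta^{\mathrm{NUM}}$ on $X$ is a linear operator acting on real-valued functions on $X$ (a numerical approximation of the Laplacian, for instance a finite difference operator); the only property required of it is the following. We say $\Delta^{\mathrm{NUM}}$ obeys a sharp $L^\infty$ estimate if the following holds for every constant $k>0$: for any bounded $f:X\to\mathbb R$ there exists a unique function $u:X\to\mathbb R$ solving $u-k\,\Delta^{\mathrm{NUM}}u=f$, and moreover $\|u\|_\infty\le\|f\|_\infty$. Here $\|u\|_\infty=\sup_{x\in X}|u(x)|$, and $f(u^n)$ in the scheme is the pointwise composition $(u^n)^3-u^n$. *)

theory Defs
  imports "HOL-Analysis.Analysis" "HOL-Library.Function_Algebras"
begin

text \<open>
  The vertex set of the graph is the type \<open>'v\<close>. The edges play no role: the only property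
  required of a graph Laplacian is that it is a linear operator on the space of all
  (possibly unbounded) real functions on the vertices.
\<close>

definition graph_laplacian :: "(('v \<Rightarrow> real) \<Rightarrow> ('v \<Rightarrow> real)) \<Rightarrow> bool" where
  "graph_laplacian L \<longleftrightarrow>
     Vector_Spaces.linear (\<lambda>c u x. c * u x) (\<lambda>c u x. c * u x) L"

text \<open>
  The supremum is taken in \<open>ereal\<close>, so that it is \<open>\<infinity>\<close> for unbounded functions;
  a supremum in \<open>real\<close> would be unspecified there.
\<close>

definition sup_norm :: "('v \<Rightarrow> real) \<Rightarrow> ereal" where
  "sup_norm u = (SUP x. ereal \<bar>u x\<bar>)"

text \<open>Uniqueness is among all functions, not just the bounded ones.\<close>

definition sharp_linf_estimate :: "(('v \<Rightarrow> real) \<Rightarrow> ('v \<Rightarrow> real)) \<Rightarrow> bool" where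
  "sharp_linf_estimate L \<longleftrightarrow>
     (\<forall>k>0. \<forall>f. bounded (range f) \<longrightarrow>
        (\<exists>!u. \<forall>x. u x - k * L u x = f x) \<and>
        (\<forall>u. (\<forall>x. u x - k * L u x = f x) \<longrightarrow> sup_norm u \<le> sup_norm f))"

definition nonlin :: "real \<Rightarrow> real" where
  "nonlin s = s ^ 3 - s"

definition fully_discrete_scheme ::
  "(('v \<Rightarrow> real) \<Rightarrow> ('v \<Rightarrow> real)) \<Rightarrow> real \<Rightarrow> real \<Rightarrow> real \<Rightarrow> (nat \<Rightarrow> 'v \<Rightarrow> real) \<Rightarrow> bool" where
  "fully_discrete_scheme L \<nu> \<tau> A u \<longleftrightarrow>
     (\<forall>n x. (u (Suc n) x - u n x) / \<tau> =
        - \<nu> * L (L (u (Suc n))) x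
        + A * L (\<lambda>y. u (Suc n) y - u n y) x
        + L (\<lambda>y. nonlin (u n y)) x)"

definition A_cr :: "real \<Rightarrow> real \<Rightarrow> real" where
  "A_cr \<nu> \<tau> = 1 + 2 * sqrt (1 + 4 / 3 * (\<nu> / \<tau>))"

end

theory Submission
  imports Defs
begin

text \<open>
  The scheme reads \<open>(1 - aL)(1 - bL) u\<^sup>n\<^sup>+\<^sup>1 = u\<^sup>n - a L h\<close> with \<open>a + b = A\<tau>\<close>, \<open>a b = \<nu>\<tau>\<close> and
  \<open>h = (\<tau>/a) ((A + 1) u\<^sup>n - (u\<^sup>n)\<^sup>3)\<close>. Since the right-hand side is \<open>(1 - aL) h + (u\<^sup>n - h)\<close>,
  two applications of the \<open>L\<^sup>\<infinity>\<close> estimate bound \<open>\<parallel>u\<^sup>n\<^sup>+\<^sup>1\<parallel>\<close> by \<open>\<parallel>h\<parallel> + \<parallel>u\<^sup>n - h\<parallel>\<close>. On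
  \<open>[-M, M]\<close> both \<open>\<bar>h(s)\<bar>\<close> and \<open>\<bar>s - h(s)\<bar>\<close> are maximal at the endpoint \<open>s = M\<close>, so that the two
  norms add up to \<open>M\<close>, provided that \<open>\<tau>(A + 1)/a \<le> 4/3\<close>. For the larger root \<open>a\<close> this is
  precisely the condition \<open>A \<ge> A\<^sub>c\<^sub>r\<close>.
\<close>

lemma sup_norm_le_iff: "sup_norm u \<le> ereal B \<longleftrightarrow> (\<forall>x. \<bar>u x\<bar> \<le> B)"
  by (simp add: sup_norm_def SUP_le_iff)

lemma graph_laplacian_add:
  assumes "graph_laplacian L"
  shows "L (\<lambda>x. u x + v x) = (\<lambda>x. L u x + L v x)"
  using module_hom.add[OF Vector_Spaces.linear.axioms(3)[OF assms[unfolded graph_laplacian_def]], of u v]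
  by (simp add: plus_fun_def)

lemma graph_laplacian_scale:
  assumes "graph_laplacian L"
  shows "L (\<lambda>x. c * u x) = (\<lambda>x. c * L u x)"
  by (rule module_hom.scale[OF Vector_Spaces.linear.axioms(3)[OF assms[unfolded graph_laplacian_def]]])

lemma graph_laplacian_diff:
  assumes "graph_laplacian L"
  shows "L (\<lambda>x. u x - v x) = (\<lambda>x. L u x - L v x)"
  using graph_laplacian_add[OF assms, of u "\<lambda>x. - 1 * v x"]
  by (subst (asm) graph_laplacian_scale[OF assms]) simp

text \<open>Only the datum \<open>f\<close> has to be bounded, never the solution \<open>u\<close>.
  The estimate therefore applies to the next iterate before anything is known about its
  size.\<close>

lemma sharp_linf_estimateD:
  assumes "sharp_linf_estimate L" "k > 0"
    and "\<And>x. \<bar>f x\<bar> \<le> B" "\<And>x. u x - k * L u x = f x"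
  shows "\<bar>u x\<bar> \<le> B"
proof -
  have "bounded (range f)"
    using assms(3) by (auto simp: bounded_iff)
  then have "sup_norm u \<le> sup_norm f"
    using assms unfolding sharp_linf_estimate_def by blast
  also have "sup_norm f \<le> ereal B"
    using assms(3) by (simp add: sup_norm_le_iff)
  finally show ?thesis
    by (simp add: sup_norm_le_iff)
qed

text \<open>The gap is r (M - t)^2 (2 M + t): the root at t = M is double because M is a critical
  point of the cubic. Oddness then gives the bound on the absolute value from t = s and t = -
  s.\<close>

lemma cubic_abs_le:
  fixes r s M :: real
  assumes "r \<ge> 0" "\<bar>s\<bar> \<le> M"
  shows "\<bar>r * (3 * M\<^sup>2 * s - s ^ 3)\<bar> \<le> r * (2 * M ^ 3)"
proof -
  have *: "r * (3 * M\<^sup>2 * t - t ^ 3) \<le> r * (2 * M ^ 3)" if "\<bar>t\<bar> \<le> M" for t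
  proof -
    have "0 \<le> r * ((M - t)\<^sup>2 * (2 * M + t))"
      using assms(1) that by (intro mult_nonneg_nonneg) auto
    also have "\<dots> = r * (2 * M ^ 3) - r * (3 * M\<^sup>2 * t - t ^ 3)"
      by algebra
    finally show ?thesis by simp
  qed
  show ?thesis
    using *[of s] *[of "- s"] assms(2) by (auto simp: abs_le_iff algebra_simps)
qed

text \<open>The gap is (M - t) (1 - r (M - t) (2 M + t)). The product (M - t) (2 M + t) peaks at t =
  - M / 2 with value 9/4 M^2, whence the condition on \<open>r\<close>.\<close>

lemma id_minus_cubic_abs_le:
  fixes r s M :: real
  assumes "r \<ge> 0" "r * (9 / 4 * M\<^sup>2) \<le> 1" "\<bar>s\<bar> \<le> M"
  shows "\<bar>s - r * (3 * M\<^sup>2 * s - s ^ 3)\<bar> \<le> M - r * (2 * M ^ 3)"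
proof -
  have *: "t - r * (3 * M\<^sup>2 * t - t ^ 3) \<le> M - r * (2 * M ^ 3)" if "\<bar>t\<bar> \<le> M" for t
  proof -
    have "r * (9 / 4 * M\<^sup>2 - (t + M / 2)\<^sup>2) \<le> r * (9 / 4 * M\<^sup>2)"
      using assms(1) by (intro mult_left_mono) auto
    then have "0 \<le> (M - t) * (1 - r * (9 / 4 * M\<^sup>2 - (t + M / 2)\<^sup>2))"
      using assms(2) that by (intro mult_nonneg_nonneg) auto
    also have "\<dots> = M - r * (2 * M ^ 3) - (t - r * (3 * M\<^sup>2 * t - t ^ 3))"
      by (simp add: field_simps power2_eq_square power3_eq_cube)
    finally show ?thesis by simp
  qed
  show ?thesis
    using *[of s] *[of "- s"] assms(3) by (auto simp: abs_le_iff algebra_simps)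
qed

text \<open>\<open>a\<close> and \<open>b\<close> are the roots \<tau> (A + d) / 2 and \<tau> (A -
  d) / 2 of X^2 - A \<tau> X + \<nu> \<tau>, and the bound on \<open>a\<close> amounts to d \<ge> (A
  + 3) / 2.\<close>

lemma A_cr_factorization:
  assumes "\<nu> > 0" "\<tau> > 0" "A \<ge> A_cr \<nu> \<tau>"
  obtains a b where "a > 0" "b > 0" "a + b = A * \<tau>" "a * b = \<nu> * \<tau>"
    and "3 / 4 * \<tau> * (A + 1) \<le> a"
proof -
  define q where "q = \<nu> / \<tau>"
  have q: "q > 0" "\<nu> = q * \<tau>"
    using assms(1,2) by (auto simp: q_def)
  have A: "2 * sqrt (1 + 4 / 3 * q) \<le> A - 1"
    using assms(3) by (simp add: A_cr_def q_def)
  have "1 \<le> sqrt (1 + 4 / 3 * q)"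
    using q by simp
  with A have "A \<ge> 3" by linarith
  have "(2 * sqrt (1 + 4 / 3 * q))\<^sup>2 \<le> (A - 1)\<^sup>2"
    using A q by (intro power_mono) auto
  then have "4 * (1 + 4 / 3 * q) \<le> (A - 1)\<^sup>2"
    using q by (simp add: power_mult_distrib)
  \<comment> \<open>Expanded, both inequalities read 3 A^2 - 6 A - 9 \<ge> 16 q.\<close>
  then have "((A + 3) / 2)\<^sup>2 \<le> A\<^sup>2 - 4 * q"
    by (simp add: power2_eq_square field_simps)
  define d where "d = sqrt (A\<^sup>2 - 4 * q)"
  have d: "(A + 3) / 2 \<le> d"
    unfolding d_def using \<open>((A + 3) / 2)\<^sup>2 \<le> _\<close> by (rule real_le_rsqrt)
  have "0 \<le> A\<^sup>2 - 4 * q"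
    using \<open>((A + 3) / 2)\<^sup>2 \<le> _\<close> zero_le_power2[of "(A + 3) / 2"] by linarith
  then have d2: "d\<^sup>2 = A\<^sup>2 - 4 * q"
    by (simp add: d_def)
  \<comment> \<open>Strictness comes from q > 0 and makes the smaller root positive.\<close>
  then have "d < A"
    using q \<open>A \<ge> 3\<close> by (intro power2_less_imp_less[of d A]) auto
  show thesis
  proof
    show "\<tau> * (A + d) / 2 > 0" "\<tau> * (A - d) / 2 > 0"
      using assms(2) d \<open>A \<ge> 3\<close> \<open>d < A\<close> by auto
    show "\<tau> * (A + d) / 2 + \<tau> * (A - d) / 2 = A * \<tau>"
      by (simp add: field_simps)
    have "\<tau> * (A + d) / 2 * (\<tau> * (A - d) / 2) = \<tau>\<^sup>2 * (A\<^sup>2 - d\<^sup>2) / 4"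
      by (simp add: power2_eq_square algebra_simps)
    also have "\<dots> = \<nu> * \<tau>"
      unfolding d2 q(2) by (simp add: power2_eq_square)
    finally show "\<tau> * (A + d) / 2 * (\<tau> * (A - d) / 2) = \<nu> * \<tau>" .
    have "\<tau> * (3 / 4 * (A + 1)) \<le> \<tau> * ((A + d) / 2)"
      using assms(2) d by (intro mult_left_mono) auto
    then show "3 / 4 * \<tau> * (A + 1) \<le> \<tau> * (A + d) / 2"
      by (simp add: algebra_simps)
  qed
qed

lemma scheme_step_abs_le:
  assumes L: "graph_laplacian L" and sharp: "sharp_linf_estimate L"
    and \<tau>: "\<tau> > 0" and ab: "a > 0" "b > 0" "a + b = A * \<tau>" "a * b = \<nu> * \<tau>"
    and a: "3 / 4 * \<tau> * (A + 1) \<le> a" and M: "3 * M\<^sup>2 = A + 1"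
    and v: "\<And>x. \<bar>v x\<bar> \<le> M"
    and step: "\<And>x. (w x - v x) / \<tau> = - \<nu> * L (L w) x + A * L (\<lambda>y. w y - v y) x
      + L (\<lambda>y. nonlin (v y)) x"
  shows "\<bar>w x\<bar> \<le> M"
proof -
  define r where "r = \<tau> / a"
  define h where "h y = r * (A * v y - nonlin (v y))" for y
  define z where "z y = w y - b * L w y" for y
  have r: "r \<ge> 0" "r * a = \<tau>"
    using \<tau> ab(1) by (auto simp: r_def)
  \<comment> \<open>With 3 M^2 = A + 1 this is exactly the lower bound on \<open>a\<close>.\<close>
  have rM: "r * (9 / 4 * M\<^sup>2) \<le> 1"
  proof -
    have "9 / 4 * M\<^sup>2 = 3 / 4 * (A + 1)"
      using M by simp
    then show ?thesis
      using a ab(1) by (simp add: r_def field_simps)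
  qed
  have h: "h y = r * (3 * M\<^sup>2 * v y - v y ^ 3)" for y
    unfolding M by (simp add: h_def nonlin_def algebra_simps)
  have Lh: "L h = (\<lambda>y. r * (A * L v y - L (\<lambda>y. nonlin (v y)) y))"
    unfolding h_def by (simp only: graph_laplacian_scale[OF L] graph_laplacian_diff[OF L])
  have Lz: "L z = (\<lambda>y. L w y - b * L (L w) y)"
    unfolding z_def by (simp only: graph_laplacian_scale[OF L] graph_laplacian_diff[OF L])
  \<comment> \<open>The scheme is (1 - a L) z = v - a L h; subtracting (1 - a L) h from both sides
    removes L from the right-hand side.\<close>
  have "(z y - h y) - a * L (\<lambda>y. z y - h y) y = v y - h y" for y
  proof -
    let ?N = "L (\<lambda>y. nonlin (v y)) y"
    have "w y - v y = \<tau> * (- \<nu> * L (L w) y + A * (L w y - L v y) + ?N)"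
      using step[of y] \<tau> by (simp add: graph_laplacian_diff[OF L] field_simps)
    also have "\<dots> = - (a * b) * L (L w) y + (a + b) * L w y - r * a * (A * L v y - ?N)"
      unfolding ab r by (simp add: algebra_simps)
    also have "\<dots> = b * L w y + a * (L z y - L h y)"
      unfolding Lh Lz by (simp add: algebra_simps)
    finally have "w y - v y = b * L w y + a * (L z y - L h y)" .
    then show ?thesis
      unfolding fun_cong[OF graph_laplacian_diff[OF L, of z h], of y] z_def[of y] by linarith
  qed
  then have zh: "\<bar>z y - h y\<bar> \<le> M - r * (2 * M ^ 3)" for y
    by (rule sharp_linf_estimateD[OF sharp ab(1), rotated])
      (unfold h, rule id_minus_cubic_abs_le[OF r(1) rM v])
  have hr: "\<bar>h y\<bar> \<le> r * (2 * M ^ 3)" for y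
    unfolding h by (rule cubic_abs_le[OF r(1) v])
  have "\<bar>z y\<bar> \<le> M" for y
    using abs_triangle_ineq[of "z y - h y" "h y"] zh[of y] hr[of y] by linarith
  then show ?thesis
    by (rule sharp_linf_estimateD[OF sharp ab(2)]) (simp add: z_def)
qed

theorem corollary1p1:
  fixes L :: "('v \<Rightarrow> real) \<Rightarrow> ('v \<Rightarrow> real)"
    and \<nu> \<tau> A M :: real
    and u :: "nat \<Rightarrow> 'v \<Rightarrow> real"
  assumes "graph_laplacian L"
    and "sharp_linf_estimate L"
    and "\<nu> > 0" and "\<tau> > 0"
    and "A \<ge> A_cr \<nu> \<tau>"
    and "bounded (range (u 0))"
    and "fully_discrete_scheme L \<nu> \<tau> A u"
    and "M = sqrt ((A + 1) / 3)"
    and "sup_norm (u 0) \<le> ereal M"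
  shows "\<forall>n\<ge>1. sup_norm (u n) \<le> ereal M"
proof -
  obtain a b where ab: "a > 0" "b > 0" "a + b = A * \<tau>" "a * b = \<nu> * \<tau>"
    "3 / 4 * \<tau> * (A + 1) \<le> a"
    using A_cr_factorization[OF assms(3-5)] by metis
  \<comment> \<open>A > 0 keeps the radicand in M nonnegative, so that squaring undoes the
    root.\<close>
  have "0 < A * \<tau>"
    using ab(1,2) by (simp flip: ab(3))
  then have "A > 0"
    using \<open>\<tau> > 0\<close> by (simp add: zero_less_mult_iff)
  then have M: "3 * M\<^sup>2 = A + 1"
    by (simp add: assms(8))
  have "\<bar>u n x\<bar> \<le> M" for n x
  proof (induction n arbitrary: x)
    case 0
    show ?case
      using assms(9) by (simp add: sup_norm_le_iff)
  next
    case (Suc n)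
    show ?case
      using assms(7)
      by (intro scheme_step_abs_le[where v = "u n", OF assms(1,2,4) ab M Suc.IH])
        (simp add: fully_discrete_scheme_def)
  qed
  then show ?thesis
    by (simp add: sup_norm_le_iff)
qed

end
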